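(* Let the functions $f_i$, $g_i$ satisfy, for every $i\in\mathcal N=\{1,\dots,N\}$: (i) $f_i(\cdot,x_{-i})$ is convex in $x_i$ for every $x_{-i}\in X_{-i}$; (ii) $g_i(x_i,x_{-i},\xi_i)=\xi_i^\top Q_i\xi_i+P_i(x)^\top\xi_i$; (iii) $P_i(x)=A_ix+b_i$ with $A_i\in\mathbb R^{m\times nN}$, $b_i\in\mathbb R^m$; (iv) $Q_i=L_i^\top D_iL_i$ with $L_i$ orthogonal and $D_i$ diagonal positive semidefinite with sorted diagonal entries. Fix radii $\varepsilon_i\ge 0$ and samples $\xi_i^{(1)},\dots,\xi_i^{(K_i)}\in\mathbb R^m$ for each $i\in\mathcal N$, and let $\mathcal P_i$ be the 2-Wasserstein ball of radius $\varepsilon_i$ around the empirical distribution of these samples. Then, for each $i\in\mathcal N$ and each $x_{-i}\in X_{-i}$, agent $i$'s problem $$\min_{x_i\in X_i}\max_{\mathbb Q_i\in\mathcal P_i}\Big\{f_i(x_i,x_{-i})+\mathbb E_{\xi_i\sim\mathbb Q_i}[g_i(x_i,x_{-i},\xi_i)]\Big\}$$ admits the dual reformulation (i.e. has the same optimal value as) $$\min_{x_i\in X_i,\ \lambda_i\ge 0}J_i(x_i,\lambda_i,x_{-i}),$$ where $$J_i(x_i,\lambda_i,x_{-i})=f_i(x_i,x_{-i})+\lambda_i\varepsilon_i^2+\frac1{K_i}\sum_{k_i=1}^{K_i}\sup_{\xi_i\in\mathbb R^m}\Big[\xi_i^\top Q_i\xi_i+P_i(x)^\top\xi_i-\lamb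da_i\|\xi_i-\xi_i^{(k_i)}\|^2\Big].$$
   Context: Each agent $i\in\mathcal N=\{1,\dots,N\}$ has a decision $x_i\in X_i\subseteq\mathbb R^n$; $x_{-i}\in X_{-i}=\prod_{j\ne i}X_j$ collects the others' decisions and $x=(x_1,\dots,x_N)\in\mathbb R^{nN}$ (also written $(x_i,x_{-i})$). $f_i:\mathbb R^n\times\mathbb R^{n(N-1)}\to\mathbb R$ and $g_i:\mathbb R^n\times\mathbb R^{n(N-1)}\times\mathbb R^m\to\mathbb R$. $\|\cdot\|$ is the Euclidean norm. The empirical distribution is $\hat{\mathbb P}_{K_i}=\frac1{K_i}\sum_{k_i=1}^{K_i}\delta_{\xi_i^{(k_i)}}$, and $\mathcal P_i=\{\mathbb Q_i \text{ probability measure on }\mathbb R^m: d_W(\mathbb Q_i,\hat{\mathbb P}_{K_i})\le\varepsilon_i\}$, where $d_W$ is the 2-Wasserstein metric $d_W(\mathbb Q_1,\mathbb Q_2)=\big(\inf_\Pi\int\|\xi_1-\xi_2\|^2\,\Pi(d\xi_1,d\xi_2)\big)^{1/2}$, the infimum being over couplings $\Pi$ of $\mathbb Q_1,\mathbb Q_2$. In optimal values, $\min$ and $\max$ are read as infimum and supremum (in the extended reals). *)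

theory Defs
  imports "HOL-Probability.Probability"
begin

text \<open>
  The agents are the elements of a finite type \<open>'N\<close>. The decisions of the opponents of agent
  \<open>i\<close> are functions on \<open>- {i}\<close>, extended by \<open>undefined\<close> at \<open>i\<close>, so that the product of the sets
  \<open>X j\<close> over \<open>j \<noteq> i\<close> is \<open>opponents X i\<close> and the whole opponents' space
  is \<open>opponents (\<lambda>_. UNIV) i\<close>.
\<close>

definition opponents :: "('N \<Rightarrow> 'a set) \<Rightarrow> 'N \<Rightarrow> ('N \<Rightarrow> 'a) set" where
  "opponents X i = Pi\<^sub>E (- {i}) X"

definition profile :: "'N::finite \<Rightarrow> 'a \<Rightarrow> ('N \<Rightarrow> 'a) \<Rightarrow> 'a^'N" where
  "profile i y z = (\<chi> j. if j = i then y else z j)"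

text \<open>The identification of an \<open>N\<close>-tuple of vectors of length \<open>n\<close> with a vector of length \<open>nN\<close>.\<close>

definition stack :: "real^'n^'N \<Rightarrow> real^('N \<times> 'n)" where
  "stack x = (\<chi> p. x $ fst p $ snd p)"

definition diagonal_matrix :: "real^'m^'m \<Rightarrow> bool" where
  "diagonal_matrix D \<longleftrightarrow> (\<forall>k l. k \<noteq> l \<longrightarrow> D $ k $ l = 0)"

definition pos_semidef :: "real^'m^'m \<Rightarrow> bool" where
  "pos_semidef D \<longleftrightarrow> transpose D = D \<and> (\<forall>v. 0 \<le> v \<bullet> (D *v v))"

text \<open>Either direction of sorting is allowed.\<close>

definition sorted_diagonal :: "real^('m::{finite,linorder})^('m::{finite,linorder}) \<Rightarrow> bool" where
  "sorted_diagonal D \<longleftrightarrow> mono (\<lambda>k. D $ k $ k) \<or> antimono (\<lambda>k. D $ k $ k)"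

text \<open>The empirical distribution of the samples \<open>s 1, \<dots>, s K\<close>; \<open>return borel a\<close> is the Dirac
  measure at \<open>a\<close>.\<close>

definition empirical :: "nat \<Rightarrow> (nat \<Rightarrow> 'a::topological_space) \<Rightarrow> 'a measure" where
  "empirical K s = measure_of UNIV (sets borel)
     (\<lambda>A. ennreal (1 / real K) * (\<Sum>k=1..K. emeasure (return borel (s k)) A))"

lemma sets_empirical [simp, measurable_cong]: "sets (empirical K s) = sets borel"
  unfolding empirical_def by (metis sets.sigma_sets_eq sets_measure_of sets.space_closed space_borel)

lemma space_empirical [simp]: "space (empirical K s) = UNIV"
  by (metis sets_empirical sets_eq_imp_space_eq space_borel)

lemma emeasure_empirical:
  assumes "A \<in> sets borel"
  shows "emeasure (empirical K s) A
    = ennreal (1 / real K) * (\<Sum>k=1..K. emeasure (return borel (s k)) A)"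
  unfolding empirical_def
proof (rule emeasure_measure_of_sigma)
  show "sigma_algebra UNIV (sets (borel :: 'a measure))"
    by (metis sets.sigma_algebra_axioms space_borel)
  show "countably_additive (sets borel)
      (\<lambda>A. ennreal (1 / real K) * (\<Sum>k=1..K. emeasure (return borel (s k)) A))"
    unfolding countably_additive_def
  proof (intro allI impI)
    fix B :: "nat \<Rightarrow> 'a set"
    assume B: "range B \<subseteq> sets borel" "disjoint_family B"
    have "(\<Sum>i. \<Sum>k=1..K. emeasure (return borel (s k)) (B i))
        = (\<Sum>k=1..K. \<Sum>i. emeasure (return borel (s k)) (B i))"
      by (rule suminf_sum) auto
    also have "\<dots> = (\<Sum>k=1..K. emeasure (return borel (s k)) (\<Union>i. B i))"
      using B by (intro sum.cong refl suminf_emeasure) auto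
    finally show "(\<Sum>i. ennreal (1 / real K) * (\<Sum>k=1..K. emeasure (return borel (s k)) (B i)))
        = ennreal (1 / real K) * (\<Sum>k=1..K. emeasure (return borel (s k)) (\<Union>i. B i))"
      by simp
  qed
qed (use assms in \<open>auto simp: positive_def\<close>)

lemma prob_space_empirical:
  assumes "K \<ge> 1"
  shows "prob_space (empirical K s)"
proof
  have "emeasure (return borel (s k)) UNIV = 1" for k
    by simp
  then have "emeasure (empirical K s) UNIV = ennreal (1 / real K) * of_nat K"
    by (subst emeasure_empirical) simp_all
  also have "\<dots> = 1"
    using assms by (simp add: ennreal_of_nat_eq_real_of_nat flip: ennreal_mult)
  finally show "emeasure (empirical K s) (space (empirical K s)) = 1"
    by simp
qed

definition couplings :: "'a measure \<Rightarrow> 'b measure \<Rightarrow> ('a \<times> 'b) measure set" where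
  "couplings M N = {\<gamma>. prob_space \<gamma> \<and> sets \<gamma> = sets (M \<Otimes>\<^sub>M N) \<and>
     distr \<gamma> M fst = M \<and> distr \<gamma> N snd = N}"

definition ennsqrt :: "ennreal \<Rightarrow> ennreal" where
  "ennsqrt a = (if a = \<top> then \<top> else ennreal (sqrt (enn2real a)))"

definition wasserstein2 :: "'a::euclidean_space measure \<Rightarrow> 'a measure \<Rightarrow> ennreal" where
  "wasserstein2 M N =
     ennsqrt (INF \<gamma>\<in>couplings M N. \<integral>\<^sup>+p. ennreal ((norm (fst p - snd p))\<^sup>2) \<partial>\<gamma>)"

definition ambiguity_set :: "real \<Rightarrow> nat \<Rightarrow> (nat \<Rightarrow> real^'m) \<Rightarrow> (real^'m) measure set" where
  "ambiguity_set \<epsilon> K s =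
     {M. prob_space M \<and> sets M = sets borel \<and> wasserstein2 M (empirical K s) \<le> ennreal \<epsilon>}"

text \<open>
  Optimal values are taken in the extended reals. The Bochner integral yields \<open>0\<close> on non-integrable
  functions; this value is never used for the quadratic \<open>g\<close> of interest, since every member of the
  ambiguity set has a finite second moment, see \<open>ambiguity_set_second_moment\<close> below.
\<close>

definition primal_value ::
  "(real^'n \<Rightarrow> ('N \<Rightarrow> real^'n) \<Rightarrow> real) \<Rightarrow> (real^'n \<Rightarrow> ('N \<Rightarrow> real^'n) \<Rightarrow> real^'m \<Rightarrow> real) \<Rightarrow>
   real \<Rightarrow> nat \<Rightarrow> (nat \<Rightarrow> real^'m) \<Rightarrow> (real^'n) set \<Rightarrow> ('N \<Rightarrow> real^'n) \<Rightarrow> ereal" where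
  "primal_value f g \<epsilon> K s X z =
     (INF y\<in>X. SUP M\<in>ambiguity_set \<epsilon> K s. ereal (f y z + (\<integral>\<xi>. g y z \<xi> \<partial>M)))"

text \<open>The objective \<open>J\<close> of the dual problem of agent \<open>i\<close>; the suprema may be \<open>\<infinity>\<close> but not
  \<open>-\<infinity>\<close>, so the sum below is never of the form \<open>\<infinity> - \<infinity>\<close>.\<close>

definition dual_objective ::
  "'N::finite \<Rightarrow> (real^'n \<Rightarrow> ('N \<Rightarrow> real^'n) \<Rightarrow> real) \<Rightarrow> real^'m^'m \<Rightarrow> (real^'n^'N \<Rightarrow> real^'m) \<Rightarrow>
   real \<Rightarrow> nat \<Rightarrow> (nat \<Rightarrow> real^'m) \<Rightarrow> real^'n \<Rightarrow> real \<Rightarrow> ('N \<Rightarrow> real^'n) \<Rightarrow> ereal" where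
  "dual_objective i f Q P \<epsilon> K s y l z =
     ereal (f y z) + ereal (l * \<epsilon>\<^sup>2) +
     ereal (1 / real K) * (\<Sum>k=1..K. SUP \<xi>.
       ereal (\<xi> \<bullet> (Q *v \<xi>) + P (profile i y z) \<bullet> \<xi> - l * (norm (\<xi> - s k))\<^sup>2))"

lemma empirical_norm_bounded:
  fixes s :: "nat \<Rightarrow> real^'m"
  shows "(\<integral>\<^sup>+x. ennreal ((norm x)\<^sup>2) \<partial>empirical K s) < \<top>"
proof -
  define B where "B = (\<Sum>k=1..K. (norm (s k))\<^sup>2)"
  have "AE x in empirical K s. (norm x)\<^sup>2 \<le> B"
  proof (rule AE_I')
    show "{x. \<not> (norm x)\<^sup>2 \<le> B} \<in> null_sets (empirical K s)"
    proof (rule null_setsI)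
      have m: "{x::real^'m. \<not> (norm x)\<^sup>2 \<le> B} \<in> sets borel"
        by measurable
      then show "{x. \<not> (norm x)\<^sup>2 \<le> B} \<in> sets (empirical K s)" by simp
      have "(norm (s k))\<^sup>2 \<le> B" if "k \<in> {1..K}" for k
        unfolding B_def using that by (intro member_le_sum) auto
      then have "(\<Sum>k=1..K. emeasure (return borel (s k)) {x. \<not> (norm x)\<^sup>2 \<le> B}) = 0"
        using m by (intro sum.neutral) (auto simp: indicator_def)
      then show "emeasure (empirical K s) {x. \<not> (norm x)\<^sup>2 \<le> B} = 0"
        using m by (simp add: emeasure_empirical)
    qed
  qed simp
  then have "(\<integral>\<^sup>+x. ennreal ((norm x)\<^sup>2) \<partial>empirical K s) \<le> (\<integral>\<^sup>+x. ennreal B \<partial>empirical K s)"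
    by (intro nn_integral_mono_AE) (auto elim!: eventually_mono intro: ennreal_leI)
  also have "\<dots> < \<top>"
    by (auto simp: emeasure_empirical ennreal_mult_less_top less_top[symmetric] ennreal_mult_eq_top_iff)
  finally show ?thesis .
qed

lemma ambiguity_set_second_moment:
  assumes M: "M \<in> ambiguity_set \<epsilon> K s"
  shows "integrable M (\<lambda>x. (norm x)\<^sup>2)"
proof -
  let ?E = "empirical K s"
  have sM [measurable_cong]: "sets M = sets borel"
    and w: "wasserstein2 M ?E \<le> ennreal \<epsilon>"
    using M by (auto simp: ambiguity_set_def)
  have "(INF \<gamma>\<in>couplings M ?E. \<integral>\<^sup>+p. ennreal ((norm (fst p - snd p))\<^sup>2) \<partial>\<gamma>) < \<top>"
    using w by (auto simp: wasserstein2_def ennsqrt_def less_top[symmetric] top_unique split: if_splits)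
  then obtain \<gamma> where \<gamma>: "\<gamma> \<in> couplings M ?E"
    and fin: "(\<integral>\<^sup>+p. ennreal ((norm (fst p - snd p))\<^sup>2) \<partial>\<gamma>) < \<top>"
    by (auto simp: INF_less_iff)
  have s\<gamma> [measurable_cong]: "sets \<gamma> = sets (M \<Otimes>\<^sub>M ?E)"
    and d: "distr \<gamma> M fst = M" "distr \<gamma> ?E snd = ?E"
    using \<gamma> by (auto simp: couplings_def)
  have "(\<integral>\<^sup>+x. ennreal ((norm x)\<^sup>2) \<partial>M) = (\<integral>\<^sup>+p. ennreal ((norm (fst p))\<^sup>2) \<partial>\<gamma>)"
    by (subst d(1)[symmetric], subst nn_integral_distr) measurable
  also have "\<dots> \<le> (\<integral>\<^sup>+p. 2 * ennreal ((norm (fst p - snd p))\<^sup>2) + 2 * ennreal ((norm (snd p))\<^sup>2) \<partial>\<gamma>)"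
  proof (rule nn_integral_mono)
    fix p :: "(real^'a) \<times> (real^'a)"
    have "norm (fst p) \<le> norm (fst p - snd p) + norm (snd p)"
      by (metis diff_add_cancel norm_triangle_ineq)
    then have "(norm (fst p))\<^sup>2 \<le> (norm (fst p - snd p) + norm (snd p))\<^sup>2"
      by (intro power_mono) auto
    also have "\<dots> \<le> 2 * (norm (fst p - snd p))\<^sup>2 + 2 * (norm (snd p))\<^sup>2"
      using sum_squares_bound[of "norm (fst p - snd p)" "norm (snd p)"]
      by (simp add: power2_sum)
    finally have "ennreal ((norm (fst p))\<^sup>2)
        \<le> ennreal (2 * (norm (fst p - snd p))\<^sup>2 + 2 * (norm (snd p))\<^sup>2)"
      by (rule ennreal_leI)
    then show "ennreal ((norm (fst p))\<^sup>2)
        \<le> 2 * ennreal ((norm (fst p - snd p))\<^sup>2) + 2 * ennreal ((norm (snd p))\<^sup>2)"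
      by (simp add: ennreal_plus ennreal_mult)
  qed
  also have "\<dots> = 2 * (\<integral>\<^sup>+p. ennreal ((norm (fst p - snd p))\<^sup>2) \<partial>\<gamma>)
      + 2 * (\<integral>\<^sup>+p. ennreal ((norm (snd p))\<^sup>2) \<partial>\<gamma>)"
    by (subst nn_integral_add, measurable) (simp add: nn_integral_cmult)
  also have "(\<integral>\<^sup>+p. ennreal ((norm (snd p))\<^sup>2) \<partial>\<gamma>) = (\<integral>\<^sup>+x. ennreal ((norm x)\<^sup>2) \<partial>?E)"
    using nn_integral_distr[of snd \<gamma> ?E "\<lambda>x. ennreal ((norm x)\<^sup>2)"] by (simp add: d(2))
  finally have "(\<integral>\<^sup>+x. ennreal ((norm x)\<^sup>2) \<partial>M) < \<top>"
    using fin empirical_norm_bounded[of K s]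
    by (auto simp: less_top[symmetric] top_unique ennreal_mult_eq_top_iff)
  then show ?thesis
    by (subst integrable_iff_bounded) (auto simp: measurable_cong_sets[OF sM refl])
qed

end

theory Submission
  imports Defs
begin

text \<open>
  Write \<open>q\<close> for the quadratic integrand and \<open>s k\<close> for the samples. Integrating
  \<open>q \<xi> \<le> l * (norm (\<xi> - s k))\<^sup>2 + (SUP \<xi>'. q \<xi>' - l * (norm (\<xi>' - s k))\<^sup>2)\<close> against a nearly optimal
  coupling gives weak duality. Conversely, it suffices to transport each sample deterministically
  to a point \<open>t k\<close> that maximises the penalised integrand of the \<open>k\<close>-th sample, with the whole budget
  \<open>(\<Sum>k=1..K. (norm (t k - s k))\<^sup>2) = K * \<epsilon>\<^sup>2\<close> spent. In the orthonormal eigenbasis of \<open>Q\<close> this is a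
  separable trust-region problem. The stationary points \<open>c / (2 * (l - d))\<close> have a total squared
  length that decreases to \<open>0\<close> as \<open>l \<rightarrow> \<infinity>\<close>, so the multiplier is found by the intermediate value
  theorem, unless the budget is not exhausted even at the largest eigenvalue (the hard case); there
  the linear term vanishes on the top eigenspace and the missing length is put in that direction
  at no cost.
\<close>

section \<open>Separable trust-region problems\<close>

text \<open>Completing the square. The bound tends to 0 as \<open>a\<close> grows, which is what the
  case of a zero budget relies on.\<close>

lemma concave_parabola_le:
  fixes a c w :: real
  assumes "a > 0"
  shows "c * w - a * w\<^sup>2 \<le> c\<^sup>2 / (4 * a)"
proof -
  have "0 \<le> (2 * a * w - c)\<^sup>2" by simp
  then have "4 * a * (c * w - a * w\<^sup>2) \<le> c\<^sup>2"
    by (simp add: power2_eq_square algebra_simps)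
  then show ?thesis
    using assms by (simp add: pos_le_divide_eq mult.commute)
qed

lemma concave_parabola_max:
  fixes a c w :: real
  assumes "a > 0"
  shows "c * w - a * w\<^sup>2 \<le> c * (c / (2 * a)) - a * (c / (2 * a))\<^sup>2"
proof -
  have "c * (c / (2 * a)) - a * (c / (2 * a))\<^sup>2 = c\<^sup>2 / (4 * a)"
    using assms by (simp add: power2_eq_square field_simps)
  then show ?thesis
    using concave_parabola_le[OF assms, of c w] by simp
qed

lemma tendsto_divide_shift_at_top:
  fixes b d e :: real
  assumes "b > 0"
  shows "((\<lambda>l. e / (b * (l - d))) \<longlongrightarrow> 0) at_top"
proof (rule tendsto_divide_0[OF tendsto_const filterlim_at_top_imp_at_infinity])
  show "filterlim (\<lambda>l. b * (l - d)) at_top at_top"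
    using assms by real_asymp
qed

text \<open>The penalised objective is a sum of one-variable functions, so at a given multiplier
  each coordinate can be maximised on its own; only the budget \<open>R\<close> couples the
  coordinates, and it determines \<open>l\<close>.\<close>

lemma separable_trust_region:
  fixes c d :: "'i \<Rightarrow> real"
  assumes I: "finite I" "I \<noteq> {}" and d: "\<forall>i\<in>I. 0 \<le> d i" and R: "R > 0"
  shows "\<exists>l\<ge>0. \<exists>v. (\<Sum>i\<in>I. (v i)\<^sup>2) = R \<and>
    (\<forall>i\<in>I. \<forall>w. (d i - l) * w\<^sup>2 + c i * w \<le> (d i - l) * (v i)\<^sup>2 + c i * v i)"
proof -
  define m where "m = Max (d ` I)"
  define F where "F l = (\<Sum>i\<in>I. (c i / (2 * (l - d i)))\<^sup>2)" for l
  have dm: "d i \<le> m" if "i \<in> I" for i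
    using that I by (simp add: m_def)
  have "m \<in> d ` I" unfolding m_def using I by (intro Max_in) auto
  then obtain i0 where i0: "i0 \<in> I" "d i0 = m" by auto
  have m0: "0 \<le> m" using bspec[OF d i0(1)] i0 by simp
  show ?thesis
  proof (cases "\<exists>l>m. R \<le> F l")
    case True
    then obtain l0 where l0: "l0 > m" "R \<le> F l0" by auto
    have "((\<lambda>l. (c i / (2 * (l - d i)))\<^sup>2) \<longlongrightarrow> 0) at_top" for i
      using tendsto_power[OF tendsto_divide_shift_at_top, of 2 "c i" "d i" 2] by simp
    then have "(F \<longlongrightarrow> (\<Sum>i\<in>I. 0)) at_top"
      unfolding F_def by (intro tendsto_sum)
    then have "\<forall>\<^sub>F l in at_top. F l < R"
      using R by (auto dest: order_tendstoD(2))
    then have "\<forall>\<^sub>F l in at_top. F l < R \<and> l0 \<le> l"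
      using eventually_ge_at_top by (rule eventually_conj)
    then obtain l1 where l1: "F l1 < R" "l0 \<le> l1"
      using eventually_happens'[OF trivial_limit_at_top_linorder] by blast
    have "continuous_on {l0..l1} F"
      unfolding F_def using l0 by (intro continuous_intros) (auto dest!: dm)
    then obtain l where l: "l0 \<le> l" "F l = R"
      using IVT2'[of F l1 R l0] l0 l1 by auto
    have pos: "l - d i > 0" if "i \<in> I" for i
      using dm[OF that] l0 l by simp
    show ?thesis
    proof (intro exI[of _ l] conjI exI[of _ "\<lambda>i. c i / (2 * (l - d i))"] ballI allI)
      show "0 \<le> l" using l l0 m0 by simp
      show "(\<Sum>i\<in>I. (c i / (2 * (l - d i)))\<^sup>2) = R" using l by (simp add: F_def)
      fix i w assume "i \<in> I"
      from concave_parabola_max[OF pos[OF this], of "c i" w]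
      show "(d i - l) * w\<^sup>2 + c i * w
          \<le> (d i - l) * (c i / (2 * (l - d i)))\<^sup>2 + c i * (c i / (2 * (l - d i)))"
        by (simp add: left_diff_distrib)
    qed
  next
    case False
    then have FR: "F l < R" if "l > m" for l
      using that by force
    have c0: "c i = 0" if i: "i \<in> I" "d i = m" for i
    proof (rule ccontr)
      assume c: "c i \<noteq> 0"
      \<comment> \<open>Chosen so that the stationary point of coordinate \<open>i\<close> alone has
        squared length \<open>R\<close>, which contradicts \<open>FR\<close>.\<close>
      define l where "l = m + \<bar>c i\<bar> / (2 * sqrt R)"
      have l: "l > m" using c R by (simp add: l_def)
      have "2 * (l - d i) = \<bar>c i\<bar> / sqrt R"
        using i by (simp add: l_def)
      then have "(c i / (2 * (l - d i)))\<^sup>2 = R"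
        using c R by (simp add: power_divide power_mult_distrib)
      moreover have "(c i / (2 * (l - d i)))\<^sup>2 \<le> F l"
        unfolding F_def using I i by (intro member_le_sum) auto
      ultimately show False using FR[OF l] by simp
    qed
    \<comment> \<open>Coordinates with \<open>d i = m\<close> have \<open>c i = 0\<close>, so
      \<open>F\<close> has no pole at \<open>m\<close> and the bound \<open>F l < R\<close> passes
      to the limit from the right.\<close>
    have "((\<lambda>l. (c i / (2 * (l - d i)))\<^sup>2) \<longlongrightarrow> (c i / (2 * (m - d i)))\<^sup>2) (at_right m)"
      if "i \<in> I" for i
    proof (cases "d i = m")
      case True
      then show ?thesis using c0[OF that] by simp
    next
      case False
      then show ?thesis by (intro tendsto_intros) auto
    qed
    then have "(F \<longlongrightarrow> F m) (at_right m)"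
      unfolding F_def by (intro tendsto_sum)
    moreover have "\<forall>\<^sub>F l in at_right m. F l \<le> R"
      using FR by (auto simp: eventually_at_right_less intro: eventually_mono[OF eventually_at_right_less] less_imp_le)
    ultimately have Fm: "F m \<le> R"
      by (intro tendsto_upperbound) auto
    \<comment> \<open>Since \<open>d i0 = m\<close>, the summand of \<open>F m\<close> at
      \<open>i0\<close> is a division by zero and hence 0, so \<open>v i0\<close> can carry exactly
      the missing length \<open>R - F m\<close>. It costs nothing: with multiplier \<open>m\<close>
      and \<open>c i0 = 0\<close> the objective in that coordinate is constant.\<close>
    define v where "v i = (if i = i0 then sqrt (R - F m) else c i / (2 * (m - d i)))" for i
    show ?thesis
    proof (intro exI[of _ m] conjI exI[of _ v] ballI allI)
      show "0 \<le> m" by (rule m0)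
      have "(\<Sum>i\<in>I. (v i)\<^sup>2) = (v i0)\<^sup>2 + (\<Sum>i\<in>I - {i0}. (v i)\<^sup>2)"
        using I i0 by (intro sum.remove)
      also have "(\<Sum>i\<in>I - {i0}. (v i)\<^sup>2) = (\<Sum>i\<in>I - {i0}. (c i / (2 * (m - d i)))\<^sup>2)"
        by (intro sum.cong) (auto simp: v_def)
      also have "\<dots> = F m"
        unfolding F_def using I i0 by (subst (2) sum.remove[of _ i0]) auto
      finally show "(\<Sum>i\<in>I. (v i)\<^sup>2) = R"
        using Fm by (simp add: v_def)
      fix i w assume i: "i \<in> I"
      show "(d i - m) * w\<^sup>2 + c i * w \<le> (d i - m) * (v i)\<^sup>2 + c i * v i"
      proof (cases "d i = m")
        case True
        then show ?thesis using c0[OF i] by simp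
      next
        case False
        then have "m - d i > 0" "i \<noteq> i0" using dm[OF i] i0 by auto
        with concave_parabola_max[of "m - d i" "c i" w] show ?thesis
          by (simp add: v_def left_diff_distrib)
      qed
    qed
  qed
qed

text \<open>The error term \<open>\<eta>\<close> is only needed for \<open>R = 0\<close>, where the optimal multiplier may be
  infinite.\<close>

lemma separable_trust_region_approx:
  fixes c d :: "'i \<Rightarrow> real"
  assumes I: "finite I" "I \<noteq> {}" and d: "\<forall>i\<in>I. 0 \<le> d i" and R: "R \<ge> 0"
    and \<eta>: "\<eta> > 0"
  shows "\<exists>l\<ge>0. \<exists>v. (\<Sum>i\<in>I. (v i)\<^sup>2) = R \<and>
    (\<forall>i\<in>I. \<forall>w. (d i - l) * w\<^sup>2 + c i * w \<le> (d i - l) * (v i)\<^sup>2 + c i * v i + \<eta>)"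
proof (cases "R = 0")
  case False
  with R have "R > 0" by simp
  from separable_trust_region[where c = c and d = d, OF I d this] obtain l v where
    "l \<ge> 0" "(\<Sum>i\<in>I. (v i)\<^sup>2) = R"
    and opt: "\<forall>i\<in>I. \<forall>w. (d i - l) * w\<^sup>2 + c i * w \<le> (d i - l) * (v i)\<^sup>2 + c i * v i"
    by (elim exE conjE)
  moreover have "(d i - l) * w\<^sup>2 + c i * w \<le> (d i - l) * (v i)\<^sup>2 + c i * v i + \<eta>"
    if "i \<in> I" for i w
    using bspec[OF opt that, THEN spec, of w] \<eta> by linarith
  ultimately show ?thesis
    by (intro exI[of _ l] conjI exI[of _ v] ballI allI)
next
  case True
  \<comment> \<open>A zero budget forces \<open>v = 0\<close>. A sufficiently large multiplier
    brings the maximum of every coordinate, at most \<open>(c i)\<^sup>2 / (4 * (l - d i))\<close>,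
    below \<eta>.\<close>
  have "((\<lambda>l. (c i)\<^sup>2 / (4 * (l - d i))) \<longlongrightarrow> 0) at_top" for i
    by (rule tendsto_divide_shift_at_top) simp
  then have "\<forall>\<^sub>F l in at_top. (c i)\<^sup>2 / (4 * (l - d i)) < \<eta> \<and> d i < l" for i
    using \<eta> by (intro eventually_conj eventually_gt_at_top) (auto dest: order_tendstoD(2))
  then have "\<forall>\<^sub>F l in at_top. \<forall>i\<in>I. (c i)\<^sup>2 / (4 * (l - d i)) < \<eta> \<and> d i < l"
    using I by (intro eventually_ball_finite) auto
  then obtain l where l: "\<And>i. i \<in> I \<Longrightarrow> (c i)\<^sup>2 / (4 * (l - d i)) < \<eta> \<and> d i < l"
    unfolding eventually_at_top_linorder by blast
  have "(d i - l) * w\<^sup>2 + c i * w \<le> \<eta>" if "i \<in> I" for i w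
    using concave_parabola_le[of "l - d i" "c i" w] l[OF that] by (simp add: left_diff_distrib)
  moreover have "l \<ge> 0" using l d I by (metis all_not_in_conv less_imp_le order_trans)
  ultimately show ?thesis
    using True by (intro exI[of _ l] conjI exI[of _ "\<lambda>_. 0"]) auto
qed

section \<open>Empirical distributions as images of uniform laws\<close>

text \<open>Makes the rules for pushforwards and finite pmfs available for integrals,
  almost-everywhere statements and couplings of empirical distributions.\<close>

lemma empirical_eq_distr:
  assumes "K \<ge> 1"
  shows "empirical K s = distr (measure_pmf (pmf_of_set {1..K})) borel s"
proof (rule measure_eqI)
  fix A assume "A \<in> sets (empirical K s)"
  then have A: "A \<in> sets borel" by simp
  have "(\<Sum>k=1..K. indicator A (s k)) = (of_nat (card ({1..K} \<inter> s -` A)) :: ennreal)"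
    by (simp add: indicator_def of_bool_def sum.If_cases Int_def vimage_def)
  then have "emeasure (empirical K s) A
      = ennreal (1 / real K) * of_nat (card ({1..K} \<inter> s -` A))"
    using A by (simp add: emeasure_empirical)
  also have "\<dots> = ennreal (real (card ({1..K} \<inter> s -` A)) / K)"
    by (simp add: ennreal_of_nat_eq_real_of_nat flip: ennreal_mult)
  also have "\<dots> = emeasure (measure_pmf (pmf_of_set {1..K})) (s -` A)"
    using assms by (subst emeasure_pmf_of_set) auto
  also have "\<dots> = emeasure (distr (measure_pmf (pmf_of_set {1..K})) borel s) A"
    using A by (simp add: emeasure_distr)
  finally show "emeasure (empirical K s) A
    = emeasure (distr (measure_pmf (pmf_of_set {1..K})) borel s) A" .
qed simp

lemma integral_empirical:
  fixes h :: "'a::topological_space \<Rightarrow> real"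
  assumes "K \<ge> 1" and [measurable]: "h \<in> borel_measurable borel"
  shows "(\<integral>x. h x \<partial>empirical K s) = (\<Sum>k=1..K. h (s k)) / K"
  using assms(1) by (simp add: empirical_eq_distr integral_distr integral_pmf_of_set)

lemma AE_empirical_range:
  fixes s :: "nat \<Rightarrow> 'a::t1_space"
  assumes "K \<ge> 1"
  shows "AE x in empirical K s. x \<in> s ` {1..K}"
proof -
  have "s ` {1..K} \<in> sets borel" by (intro borel_closed finite_imp_closed) auto
  then show ?thesis
    unfolding empirical_eq_distr[OF assms] using assms
    by (subst AE_distr_iff) (auto simp: AE_measure_pmf_iff)
qed

lemma ennsqrt_le_iff:
  assumes "\<epsilon> \<ge> 0"
  shows "ennsqrt a \<le> ennreal \<epsilon> \<longleftrightarrow> a \<le> ennreal (\<epsilon>\<^sup>2)"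
proof (cases a)
  case (real r)
  moreover have "sqrt r \<le> \<epsilon> \<longleftrightarrow> r \<le> \<epsilon>\<^sup>2"
    by (metis abs_of_nonneg assms real_sqrt_abs real_sqrt_le_iff)
  ultimately show ?thesis
    using assms by (simp add: ennsqrt_def)
next
  case top
  then show ?thesis by (simp add: ennsqrt_def top_unique)
qed

section \<open>Weak duality\<close>

text \<open>The hypothesis on \<open>r\<close> is integrated against the coupling: the first
  marginal yields the integral of \<open>q\<close>, the transport cost is at most \<open>C\<close>,
  and the second marginal averages the bounds over the samples.\<close>

lemma integral_coupling_le:
  fixes s :: "nat \<Rightarrow> 'a::euclidean_space" and q :: "'a \<Rightarrow> real"
  assumes \<gamma>: "\<gamma> \<in> couplings M (empirical K s)" and sM: "sets M = sets borel" and K: "K \<ge> 1"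
    and l: "l \<ge> 0" and C: "C \<ge> 0"
    and cost: "(\<integral>\<^sup>+p. ennreal ((norm (fst p - snd p))\<^sup>2) \<partial>\<gamma>) \<le> ennreal C"
    and q: "integrable M q"
    and r: "\<And>k \<xi>. k \<in> {1..K} \<Longrightarrow> q \<xi> - l * (norm (\<xi> - s k))\<^sup>2 \<le> r k"
  shows "(\<integral>\<xi>. q \<xi> \<partial>M) \<le> l * C + (\<Sum>k=1..K. r k) / K"
proof -
  let ?E = "empirical K s"
  let ?S = "s ` {1..K}"
  \<comment> \<open>The coupling sees sample points, not their indices, and samples may coincide
    while their \<open>r k\<close> differ. Hence the bound is replaced by a function of the point
    that lies below every matching \<open>r k\<close>.\<close>
  define \<phi> where "\<phi> x = (SUP \<xi>. q \<xi> - l * (norm (\<xi> - x))\<^sup>2)" for x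
  \<comment> \<open>Away from the samples the supremum may be over an unbounded set and carry no
    information. The finite sum of indicators keeps only the values at the samples and is measurable
    and bounded.\<close>
  define h where "h x = (\<Sum>a\<in>?S. \<phi> a * indicator {a} x)" for x
  have s\<gamma> [measurable_cong]: "sets \<gamma> = sets (M \<Otimes>\<^sub>M ?E)"
    and d: "distr \<gamma> M fst = M" "distr \<gamma> ?E snd = ?E" and "prob_space \<gamma>"
    using \<gamma> by (auto simp: couplings_def)
  interpret prob_space \<gamma> by fact
  note sM [measurable_cong]
  have [measurable]: "q \<in> borel_measurable M" using q by simp
  have [measurable]: "h \<in> borel_measurable borel" unfolding h_def by measurable
  have hS: "h x = \<phi> x" if "x \<in> ?S" for x
    using that by (simp add: h_def indicator_def sum.delta' if_distrib cong: if_cong)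
  have up: "q \<xi> - l * (norm (\<xi> - s k))\<^sup>2 \<le> \<phi> (s k)" if "k \<in> {1..K}" for k \<xi>
    unfolding \<phi>_def using r[OF that] by (intro cSUP_upper bdd_aboveI2) auto
  have low: "\<phi> (s k) \<le> r k" if "k \<in> {1..K}" for k
    unfolding \<phi>_def using r[OF that] by (intro cSUP_least) auto
  have int_cost: "integrable \<gamma> (\<lambda>p. (norm (fst p - snd p))\<^sup>2)"
    using cost by (subst integrable_iff_bounded) (auto intro: le_less_trans)
  have cost': "(\<integral>p. (norm (fst p - snd p))\<^sup>2 \<partial>\<gamma>) \<le> C"
    using cost C by (subst (asm) nn_integral_eq_integral[OF int_cost]) auto
  have int_h: "integrable \<gamma> (\<lambda>p. h (snd p))"
  proof (rule integrable_const_bound)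
    show "AE p in \<gamma>. norm (h (snd p)) \<le> (\<Sum>a\<in>?S. \<bar>\<phi> a\<bar>)"
      unfolding h_def real_norm_def
      by (intro AE_I2 order_trans[OF sum_abs] sum_mono) (auto simp: indicator_def)
  qed measurable
  have int_q: "integrable \<gamma> (\<lambda>p. q (fst p))"
    using q by (subst (asm) d(1)[symmetric], subst (asm) integrable_distr_eq) auto
  have "AE x in distr \<gamma> ?E snd. x \<in> ?S"
    unfolding d(2) by (rule AE_empirical_range[OF K])
  then have AE_S: "AE p in \<gamma>. snd p \<in> ?S"
    by (rule AE_distrD[rotated]) measurable
  have "(\<integral>\<xi>. q \<xi> \<partial>M) = (\<integral>p. q (fst p) \<partial>\<gamma>)"
    by (subst d(1)[symmetric], subst integral_distr) auto
  also have "\<dots> \<le> (\<integral>p. l * (norm (fst p - snd p))\<^sup>2 + h (snd p) \<partial>\<gamma>)"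
  proof (rule integral_mono_AE)
    show "AE p in \<gamma>. q (fst p) \<le> l * (norm (fst p - snd p))\<^sup>2 + h (snd p)"
      using AE_S
    proof eventually_elim
      case (elim p)
      then obtain k where k: "k \<in> {1..K}" "snd p = s k" by auto
      show ?case using up[OF k(1), of "fst p"] hS[OF elim] k(2) by simp
    qed
  qed (use int_q int_cost int_h in auto)
  also have "\<dots> = l * (\<integral>p. (norm (fst p - snd p))\<^sup>2 \<partial>\<gamma>) + (\<integral>p. h (snd p) \<partial>\<gamma>)"
    using int_cost int_h by simp
  also have "(\<integral>p. h (snd p) \<partial>\<gamma>) = (\<integral>x. h x \<partial>?E)"
    using integral_distr[of snd \<gamma> ?E h] by (simp add: d(2))
  also have "\<dots> = (\<Sum>k=1..K. \<phi> (s k)) / K"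
    using K by (simp add: integral_empirical hS)
  also have "\<dots> \<le> (\<Sum>k=1..K. r k) / K"
    by (intro divide_right_mono sum_mono low) auto
  also have "l * (\<integral>p. (norm (fst p - snd p))\<^sup>2 \<partial>\<gamma>) \<le> l * C"
    using cost' l by (rule mult_left_mono)
  finally show ?thesis by simp
qed

text \<open>Attainment of the infimum over couplings is avoided: a coupling of cost slightly above
  \<open>\<epsilon>\<^sup>2\<close> is taken and the excess is sent to 0.\<close>

lemma weak_duality:
  fixes s :: "nat \<Rightarrow> real^'m" and q :: "real^'m \<Rightarrow> real"
  assumes M: "M \<in> ambiguity_set \<epsilon> K s" and K: "K \<ge> 1" and \<epsilon>: "\<epsilon> \<ge> 0"
    and l: "l \<ge> 0" and q: "integrable M q"
    and r: "\<And>k \<xi>. k \<in> {1..K} \<Longrightarrow> q \<xi> - l * (norm (\<xi> - s k))\<^sup>2 \<le> r k"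
  shows "(\<integral>\<xi>. q \<xi> \<partial>M) \<le> l * \<epsilon>\<^sup>2 + (\<Sum>k=1..K. r k) / K"
proof (rule field_le_epsilon)
  fix e :: real assume e: "0 < e"
  \<comment> \<open>The denominator \<open>l + 1\<close> keeps \<open>l\<close> times the excess
    below \<open>e\<close> and is positive even for \<open>l = 0\<close>.\<close>
  define C where "C = \<epsilon>\<^sup>2 + e / (l + 1)"
  have C: "\<epsilon>\<^sup>2 < C" using e l by (simp add: C_def)
  then have C0: "0 \<le> C" using zero_le_power2[of \<epsilon>] by linarith
  have sM: "sets M = sets borel" and w: "wasserstein2 M (empirical K s) \<le> ennreal \<epsilon>"
    using M by (auto simp: ambiguity_set_def)
  have "(INF \<gamma>\<in>couplings M (empirical K s). \<integral>\<^sup>+p. ennreal ((norm (fst p - snd p))\<^sup>2) \<partial>\<gamma>)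
      \<le> ennreal (\<epsilon>\<^sup>2)"
    using w \<epsilon> by (simp add: wasserstein2_def ennsqrt_le_iff)
  also have "\<dots> < ennreal C" using C le_less_trans[OF zero_le_power2 C] by (intro ennreal_lessI)
  finally obtain \<gamma> where \<gamma>: "\<gamma> \<in> couplings M (empirical K s)"
    and cost: "(\<integral>\<^sup>+p. ennreal ((norm (fst p - snd p))\<^sup>2) \<partial>\<gamma>) < ennreal C"
    by (auto simp: INF_less_iff)
  have "(\<integral>\<xi>. q \<xi> \<partial>M) \<le> l * C + (\<Sum>k=1..K. r k) / K"
    by (rule integral_coupling_le[OF \<gamma> sM K l C0 less_imp_le[OF cost] q r])
  also have "l * C \<le> l * \<epsilon>\<^sup>2 + e"
    using e l by (simp add: C_def field_simps)
  finally show "(\<integral>\<xi>. q \<xi> \<partial>M) \<le> l * \<epsilon>\<^sup>2 + (\<Sum>k=1..K. r k) / K + e" by simp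
qed

section \<open>Deterministic transport of the samples\<close>

text \<open>The joint law of \<open>t k\<close> and \<open>s k\<close> for a uniformly drawn index
  \<open>k\<close> is a coupling, and its cost is the average that \<open>cost\<close>
  bounds.\<close>

lemma empirical_in_ambiguity_set:
  fixes s t :: "nat \<Rightarrow> real^'m"
  assumes K: "K \<ge> 1" and \<epsilon>: "\<epsilon> \<ge> 0"
    and cost: "(\<Sum>k=1..K. (norm (t k - s k))\<^sup>2) / K \<le> \<epsilon>\<^sup>2"
  shows "empirical K t \<in> ambiguity_set \<epsilon> K s"
proof -
  let ?U = "measure_pmf (pmf_of_set {1..K})"
  define \<gamma> where "\<gamma> = distr ?U (borel \<Otimes>\<^sub>M borel) (\<lambda>k. (t k, s k))"
  have "\<gamma> \<in> couplings (empirical K t) (empirical K s)"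
    unfolding couplings_def
  proof (intro CollectI conjI)
    show "prob_space \<gamma>"
      unfolding \<gamma>_def by (intro measure_pmf.prob_space_distr) (simp add: space_pair_measure)
    show "sets \<gamma> = sets (empirical K t \<Otimes>\<^sub>M empirical K s)"
      unfolding \<gamma>_def sets_distr by (intro sets_pair_measure_cong) simp_all
    have "distr \<gamma> (empirical K t) fst = distr \<gamma> borel fst"
      by (intro distr_cong) auto
    also have "\<dots> = distr ?U borel t"
      unfolding \<gamma>_def by (subst distr_distr) (auto simp: comp_def space_pair_measure)
    finally show "distr \<gamma> (empirical K t) fst = empirical K t"
      by (simp add: empirical_eq_distr[OF K])
    have "distr \<gamma> (empirical K s) snd = distr \<gamma> borel snd"
      by (intro distr_cong) auto
    also have "\<dots> = distr ?U borel s"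
      unfolding \<gamma>_def by (subst distr_distr) (auto simp: comp_def space_pair_measure)
    finally show "distr \<gamma> (empirical K s) snd = empirical K s"
      by (simp add: empirical_eq_distr[OF K])
  qed
  moreover have "(\<integral>\<^sup>+p. ennreal ((norm (fst p - snd p))\<^sup>2) \<partial>\<gamma>)
      = (\<integral>\<^sup>+k. ennreal ((norm (t k - s k))\<^sup>2) \<partial>?U)"
    unfolding \<gamma>_def by (subst nn_integral_distr) (auto simp: space_pair_measure)
  moreover have "\<dots> = ennreal (\<integral>k. (norm (t k - s k))\<^sup>2 \<partial>?U)"
    using K by (intro nn_integral_eq_integral integrable_measure_pmf_finite) auto
  moreover have "\<dots> \<le> ennreal (\<epsilon>\<^sup>2)"
    using K cost by (intro ennreal_leI) (simp add: integral_pmf_of_set)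
  ultimately have "(INF \<gamma>\<in>couplings (empirical K t) (empirical K s).
      \<integral>\<^sup>+p. ennreal ((norm (fst p - snd p))\<^sup>2) \<partial>\<gamma>) \<le> ennreal (\<epsilon>\<^sup>2)"
    by (metis (no_types, lifting) INF_lower2)
  then show ?thesis
    using K \<epsilon> by (simp add: ambiguity_set_def prob_space_empirical wasserstein2_def ennsqrt_le_iff)
qed


section \<open>Quadratic forms in the orthonormal eigenbasis\<close>

lemma inner_matrix_vector_transpose:
  fixes B :: "real^'m^'n"
  shows "x \<bullet> (B *v y) = (transpose B *v x) \<bullet> y"
  by (simp add: dot_lmul_matrix)

lemma orthogonal_matrix_inner:
  fixes L :: "real^'m^'m"
  assumes "orthogonal_matrix L"
  shows "(L *v x) \<bullet> (L *v y) = x \<bullet> y"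
  using assms
  by (simp add: inner_matrix_vector_transpose matrix_vector_mul_assoc orthogonal_matrix)

lemma diagonal_quadratic_form:
  fixes D :: "real^'m^'m"
  assumes "diagonal_matrix D"
  shows "v \<bullet> (D *v v) = (\<Sum>j\<in>UNIV. D $ j $ j * (v $ j)\<^sup>2)"
proof -
  have "(D *v v) $ j = D $ j $ j * v $ j" for j
  proof -
    have "(D *v v) $ j = (\<Sum>k\<in>UNIV. if k = j then D $ j $ j * v $ j else 0)"
      using assms unfolding matrix_vector_mult_def vec_lambda_beta diagonal_matrix_def
      by (intro sum.cong) auto
    then show ?thesis by simp
  qed
  then show ?thesis
    by (simp add: inner_vec_def power2_eq_square algebra_simps)
qed

text \<open>Symmetry of \<open>Q\<close> merges the cross terms into one linear form with
  coefficient \<open>2 *\<^sub>R (Q *v s) + p\<close>. The isometry \<open>L\<close> diagonalises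
  the quadratic form and turns the penalty into a sum of squares in the same coordinates, so no term
  mixes two coordinates.\<close>

lemma quadratic_penalty_expansion:
  fixes Q L D :: "real^'m^'m"
  assumes Q: "Q = transpose L ** D ** L" and L: "orthogonal_matrix L"
    and D: "diagonal_matrix D" "transpose D = D"
  shows "(s + u) \<bullet> (Q *v (s + u)) + p \<bullet> (s + u) - l * (norm u)\<^sup>2
    = s \<bullet> (Q *v s) + p \<bullet> s
      + (\<Sum>j\<in>UNIV. (D $ j $ j - l) * ((L *v u) $ j)\<^sup>2
          + (L *v (2 *\<^sub>R (Q *v s) + p)) $ j * (L *v u) $ j)"
proof -
  have "transpose Q = Q"
    by (simp add: Q matrix_transpose_mul D matrix_mul_assoc)
  then have sym: "s \<bullet> (Q *v u) = u \<bullet> (Q *v s)"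
    by (simp add: inner_matrix_vector_transpose[of s] inner_commute)
  have "u \<bullet> (Q *v u) = (L *v u) \<bullet> (D *v (L *v u))"
    using inner_matrix_vector_transpose[of u "transpose L"]
    by (simp only: Q transpose_transpose flip: matrix_vector_mul_assoc)
  then have quad: "u \<bullet> (Q *v u) = (\<Sum>j\<in>UNIV. D $ j $ j * ((L *v u) $ j)\<^sup>2)"
    by (simp add: diagonal_quadratic_form D)
  have lin: "2 * (u \<bullet> (Q *v s)) + p \<bullet> u
      = (\<Sum>j\<in>UNIV. (L *v (2 *\<^sub>R (Q *v s) + p)) $ j * (L *v u) $ j)"
    using orthogonal_matrix_inner[OF L, of "2 *\<^sub>R (Q *v s) + p" u]
    by (simp add: inner_vec_def[of "L *v _"] inner_add_right inner_commute mult.commute)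
  have nrm: "(norm u)\<^sup>2 = (\<Sum>j\<in>UNIV. ((L *v u) $ j)\<^sup>2)"
    using orthogonal_matrix_inner[OF L, of u u]
    unfolding power2_norm_eq_inner by (simp add: inner_vec_def[of "L *v _"] power2_eq_square)
  have "(s + u) \<bullet> (Q *v (s + u)) + p \<bullet> (s + u) - l * (norm u)\<^sup>2
      = s \<bullet> (Q *v s) + p \<bullet> s
        + (u \<bullet> (Q *v u) + (2 * (u \<bullet> (Q *v s)) + p \<bullet> u) - l * (norm u)\<^sup>2)"
    by (simp add: matrix_vector_right_distrib inner_add_left inner_add_right sym algebra_simps)
  also have "u \<bullet> (Q *v u) + (2 * (u \<bullet> (Q *v s)) + p \<bullet> u) - l * (norm u)\<^sup>2
      = (\<Sum>j\<in>UNIV. (D $ j $ j - l) * ((L *v u) $ j)\<^sup>2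
          + (L *v (2 *\<^sub>R (Q *v s) + p)) $ j * (L *v u) $ j)"
    unfolding quad lin nrm
    by (simp add: sum.distrib sum_subtractf sum_distrib_left left_diff_distrib)
  finally show ?thesis .
qed

lemma quadratic_borel_measurable [measurable]:
  fixes Q :: "real^'m^'m"
  shows "(\<lambda>x. x \<bullet> (Q *v x) + p \<bullet> x) \<in> borel_measurable borel"
  by (intro borel_measurable_continuous_onI continuous_intros
      linear_continuous_on_compose[OF _ matrix_vector_mul_linear])

text \<open>By Cauchy-Schwarz the integrand is dominated by a multiple of the squared norm plus a
  constant, and second moments are finite on the ambiguity set.\<close>

lemma integrable_quadratic:
  fixes Q :: "real^'m^'m"
  assumes M: "M \<in> ambiguity_set \<epsilon> K s"
  shows "integrable M (\<lambda>x. x \<bullet> (Q *v x) + p \<bullet> x)"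
proof -
  have sM [measurable_cong]: "sets M = sets borel" and "prob_space M"
    using M by (auto simp: ambiguity_set_def)
  interpret prob_space M by fact
  obtain B where B: "\<And>x. norm (Q *v x) \<le> B * norm x"
    using linear_bounded[OF matrix_vector_mul_linear[of Q]] by auto
  have bound: "\<bar>x \<bullet> (Q *v x) + p \<bullet> x\<bar> \<le> (B + norm p) * (norm x)\<^sup>2 + norm p" for x
  proof -
    have "\<bar>x \<bullet> (Q *v x)\<bar> \<le> norm x * (B * norm x)"
      by (rule order_trans[OF Cauchy_Schwarz_ineq2 mult_left_mono[OF B]]) simp
    moreover have "\<bar>p \<bullet> x\<bar> \<le> norm p * norm x" by (rule Cauchy_Schwarz_ineq2)
    moreover have "norm p * norm x \<le> norm p * (1 + (norm x)\<^sup>2)"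
    proof (rule mult_left_mono)
      show "norm x \<le> 1 + (norm x)\<^sup>2"
        using sum_squares_bound[of 1 "norm x"] norm_ge_zero[of x] unfolding power_one by linarith
    qed simp
    ultimately show ?thesis
      using abs_triangle_ineq[of "x \<bullet> (Q *v x)" "p \<bullet> x"]
      by (simp add: power2_eq_square algebra_simps)
  qed
  have "integrable M (\<lambda>x. (B + norm p) * (norm x)\<^sup>2 + norm p)"
    using ambiguity_set_second_moment[OF M] by simp
  then show ?thesis
    by (rule Bochner_Integration.integrable_bound)
      (use bound in \<open>auto intro!: AE_I2 intro: order_trans[OF _ abs_ge_self]\<close>)
qed

section \<open>Strong duality\<close>

text \<open>All samples share one multiplier and one budget, so a single trust-region problem is
  posed on the pairs \<open>(k, j)\<close> of a sample index and an eigencoordinate, with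
  \<open>R = K * \<epsilon>\<^sup>2\<close>.\<close>

lemma strong_duality_witness:
  fixes Q L D :: "real^'m^'m" and s :: "nat \<Rightarrow> real^'m" and p :: "real^'m"
    and \<epsilon> :: real
  assumes Q: "Q = transpose L ** D ** L" and L: "orthogonal_matrix L"
    and D: "diagonal_matrix D" "pos_semidef D" and \<epsilon>: "\<epsilon> \<ge> 0" and K: "K \<ge> 1"
    and \<eta>: "\<eta> > 0"
  defines "q \<equiv> \<lambda>x. x \<bullet> (Q *v x) + p \<bullet> x"
  shows "\<exists>l\<ge>0. \<exists>t. (\<Sum>k=1..K. (norm (t k - s k))\<^sup>2) = K * \<epsilon>\<^sup>2 \<and>
    (\<forall>k\<in>{1..K}. \<forall>\<xi>. q \<xi> - l * (norm (\<xi> - s k))\<^sup>2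
      \<le> q (t k) - l * (norm (t k - s k))\<^sup>2 + \<eta>)"
proof -
  define c where "c k = L *v (2 *\<^sub>R (Q *v s k) + p)" for k
  have DT: "transpose D = D" using D by (simp add: pos_semidef_def)
  have exp: "q \<xi> - l * (norm (\<xi> - s k))\<^sup>2 = q (s k)
      + (\<Sum>j\<in>UNIV. (D $ j $ j - l) * ((L *v (\<xi> - s k)) $ j)\<^sup>2 + c k $ j * (L *v (\<xi> - s k)) $ j)"
    for \<xi> l k
    using quadratic_penalty_expansion[OF Q L D(1) DT, of "s k" "\<xi> - s k" p l]
    by (simp add: q_def c_def)
  have D0: "0 \<le> D $ j $ j" for j
  proof -
    \<comment> \<open>Testing semidefiniteness on a coordinate vector extracts the diagonal
      entry.\<close>
    have "0 \<le> axis j 1 \<bullet> (D *v axis j (1::real))" using D by (simp add: pos_semidef_def)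
    then show ?thesis by (simp add: inner_axis' matrix_vector_mul_component inner_axis)
  qed
  \<comment> \<open>The error is split evenly over the coordinates, so that each sample loses \<eta>
    in total.\<close>
  define n where "n = real CARD('m)"
  have n: "n > 0" by (simp add: n_def)
  have "\<exists>l\<ge>0. \<exists>v :: nat \<times> 'm \<Rightarrow> real. (\<Sum>i\<in>{1..K} \<times> (UNIV :: 'm set). (v i)\<^sup>2) = K * \<epsilon>\<^sup>2 \<and>
    (\<forall>i\<in>{1..K} \<times> UNIV. \<forall>w. (D $ snd i $ snd i - l) * w\<^sup>2 + c (fst i) $ snd i * w
      \<le> (D $ snd i $ snd i - l) * (v i)\<^sup>2 + c (fst i) $ snd i * v i + \<eta> / n)"
    using K D0 \<eta> n by (intro separable_trust_region_approx) auto
  then obtain l v where l: "l \<ge> 0"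
    and v: "(\<Sum>i\<in>{1..K} \<times> (UNIV :: 'm set). (v i)\<^sup>2) = K * \<epsilon>\<^sup>2"
    and opt: "\<And>k j w. k \<in> {1..K} \<Longrightarrow> (D $ j $ j - l) * w\<^sup>2 + c k $ j * w
      \<le> (D $ j $ j - l) * (v (k, j))\<^sup>2 + c k $ j * v (k, j) + \<eta> / n"
    by fastforce
  \<comment> \<open>The solution gives the displacement in eigencoordinates;
    \<open>transpose L\<close> rotates it back.\<close>
  define t where "t k = s k + transpose L *v (\<chi> j. v (k, j))" for k
  have Lt: "L *v (t k - s k) = (\<chi> j. v (k, j))" for k
    using L by (simp add: t_def matrix_vector_mul_assoc orthogonal_matrix_def del: transpose_matrix_vector)
  show ?thesis
  proof (intro exI[of _ l] conjI exI[of _ t] ballI allI l)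
    have "(norm (t k - s k))\<^sup>2 = (\<Sum>j\<in>UNIV. (v (k, j))\<^sup>2)" for k
      using orthogonal_matrix_inner[OF L, of "t k - s k" "t k - s k"]
      by (simp add: Lt power2_norm_eq_inner) (simp add: inner_vec_def power2_eq_square)
    then show "(\<Sum>k=1..K. (norm (t k - s k))\<^sup>2) = K * \<epsilon>\<^sup>2"
      using v by (simp add: sum.cartesian_product split_def)
    fix k \<xi> assume k: "k \<in> {1..K}"
    have "(\<Sum>j\<in>UNIV. (D $ j $ j - l) * ((L *v (\<xi> - s k)) $ j)\<^sup>2 + c k $ j * (L *v (\<xi> - s k)) $ j)
      \<le> (\<Sum>j\<in>UNIV. (D $ j $ j - l) * (v (k, j))\<^sup>2 + c k $ j * v (k, j) + \<eta> / n)"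
      by (intro sum_mono opt k)
    also have "\<dots> = (\<Sum>j\<in>UNIV. (D $ j $ j - l) * (v (k, j))\<^sup>2 + c k $ j * v (k, j)) + \<eta>"
      using n by (simp add: sum.distrib n_def)
    finally show "q \<xi> - l * (norm (\<xi> - s k))\<^sup>2 \<le> q (t k) - l * (norm (t k - s k))\<^sup>2 + \<eta>"
      unfolding exp Lt by simp
  qed
qed

text \<open>Duality at one fixed decision, with \<open>a\<close> standing for the part of the cost
  that does not depend on the random variable.\<close>

lemma wasserstein_quadratic_duality:
  fixes Q L D :: "real^'m^'m" and s :: "nat \<Rightarrow> real^'m" and p :: "real^'m"
    and \<epsilon> :: real
  assumes Q: "Q = transpose L ** D ** L" and L: "orthogonal_matrix L"
    and D: "diagonal_matrix D" "pos_semidef D" and \<epsilon>: "\<epsilon> \<ge> 0" and K: "K \<ge> 1"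
  defines "q \<equiv> \<lambda>x. x \<bullet> (Q *v x) + p \<bullet> x"
  shows "(SUP M\<in>ambiguity_set \<epsilon> K s. ereal (a + (\<integral>\<xi>. q \<xi> \<partial>M)))
    = (INF l\<in>{0..}. ereal a + ereal (l * \<epsilon>\<^sup>2)
        + ereal (1 / real K) * (\<Sum>k=1..K. SUP \<xi>. ereal (q \<xi> - l * (norm (\<xi> - s k))\<^sup>2)))"
    (is "(SUP M\<in>_. ?p M) = (INF l\<in>_. ?d l)")
proof (rule antisym)
  show "(SUP M\<in>ambiguity_set \<epsilon> K s. ?p M) \<le> (INF l\<in>{0..}. ?d l)"
  proof (intro SUP_least INF_greatest)
    fix M l assume M: "M \<in> ambiguity_set \<epsilon> K s" and "l \<in> {0::real..}"
    then have l: "l \<ge> 0" by simp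
    define \<phi> where "\<phi> k = (SUP \<xi>. ereal (q \<xi> - l * (norm (\<xi> - s k))\<^sup>2))" for k
    have up: "ereal (q \<xi> - l * (norm (\<xi> - s k))\<^sup>2) \<le> \<phi> k" for k \<xi>
      unfolding \<phi>_def by (rule SUP_upper) simp
    then have minf: "\<phi> k \<noteq> -\<infinity>" for k by (metis ereal_infty_less_eq(2) ereal.distinct(3) MInfty_neq_ereal(1))
    \<comment> \<open>One infinite supremum already makes the dual objective infinite. Otherwise all
      suprema are real and serve as the bounds \<open>r\<close> in
      \<open>weak_duality\<close>.\<close>
    show "?p M \<le> ?d l"
      unfolding \<phi>_def[symmetric]
    proof (cases "\<exists>k\<in>{1..K}. \<phi> k = \<infinity>")
      case True
      then have "sum \<phi> {1..K} = \<infinity>" by (simp add: sum_Pinfty)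
      then show "?p M \<le> ereal a + ereal (l * \<epsilon>\<^sup>2) + ereal (1 / real K) * sum \<phi> {1..K}"
        using K by simp
    next
      case False
      define r where "r k = real_of_ereal (\<phi> k)" for k
      have r: "\<phi> k = ereal (r k)" if "k \<in> {1..K}" for k
        using False that minf[of k] by (cases "\<phi> k") (auto simp: r_def)
      have "q \<xi> - l * (norm (\<xi> - s k))\<^sup>2 \<le> r k" if "k \<in> {1..K}" for k \<xi>
        using up[of \<xi> k] r[OF that] by simp
      then have "(\<integral>\<xi>. q \<xi> \<partial>M) \<le> l * \<epsilon>\<^sup>2 + (\<Sum>k=1..K. r k) / K"
        unfolding q_def by (intro weak_duality[OF M K \<epsilon> l integrable_quadratic[OF M]])
      moreover have "sum \<phi> {1..K} = ereal (\<Sum>k=1..K. r k)"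
        using r by (simp flip: sum_ereal)
      ultimately show "?p M \<le> ereal a + ereal (l * \<epsilon>\<^sup>2) + ereal (1 / real K) * sum \<phi> {1..K}"
        by simp
    qed
  qed
  show "(INF l\<in>{0..}. ?d l) \<le> (SUP M\<in>ambiguity_set \<epsilon> K s. ?p M)"
  proof (rule ereal_le_epsilon2)
    fix \<eta> :: real assume \<eta>: "0 < \<eta>"
    obtain l t where l: "l \<ge> 0" and t: "(\<Sum>k=1..K. (norm (t k - s k))\<^sup>2) = K * \<epsilon>\<^sup>2"
      and opt: "\<And>k \<xi>. k \<in> {1..K} \<Longrightarrow> q \<xi> - l * (norm (\<xi> - s k))\<^sup>2
        \<le> q (t k) - l * (norm (t k - s k))\<^sup>2 + \<eta>"
      using strong_duality_witness[OF Q L D \<epsilon> K \<eta>, of s p] unfolding q_def by blast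
    have mem: "empirical K t \<in> ambiguity_set \<epsilon> K s"
      using K \<epsilon> t by (intro empirical_in_ambiguity_set) auto
    have "(\<Sum>k=1..K. SUP \<xi>. ereal (q \<xi> - l * (norm (\<xi> - s k))\<^sup>2))
        \<le> (\<Sum>k=1..K. ereal (q (t k) - l * (norm (t k - s k))\<^sup>2 + \<eta>))"
      using opt by (intro sum_mono SUP_least) auto
    also have "\<dots> = ereal ((\<Sum>k=1..K. q (t k)) - l * (K * \<epsilon>\<^sup>2) + K * \<eta>)"
      by (simp add: sum.distrib sum_subtractf sum_distrib_left[symmetric] t[unfolded One_nat_def])
    finally have "?d l \<le> ereal a + ereal (l * \<epsilon>\<^sup>2)
        + ereal (1 / real K) * ereal ((\<Sum>k=1..K. q (t k)) - l * (K * \<epsilon>\<^sup>2) + K * \<eta>)"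
      by (intro add_left_mono ereal_mult_left_mono) auto
    \<comment> \<open>Complementary slackness: the budget is spent exactly, so the averaged penalty
      cancels \<open>l * \<epsilon>\<^sup>2\<close>.\<close>
    also have "\<dots> = ereal (a + (\<Sum>k=1..K. q (t k)) / K) + ereal \<eta>"
      using K by (simp add: field_simps)
    also have "(\<Sum>k=1..K. q (t k)) / K = (\<integral>\<xi>. q \<xi> \<partial>empirical K t)"
      using K unfolding q_def by (subst integral_empirical) auto
    also have "?p (empirical K t) \<le> (SUP M\<in>ambiguity_set \<epsilon> K s. ?p M)"
      using mem by (rule SUP_upper)
    finally have "?d l \<le> (SUP M\<in>ambiguity_set \<epsilon> K s. ?p M) + ereal \<eta>"
      by (simp add: add_right_mono)
    with l show "(INF l\<in>{0..}. ?d l) \<le> (SUP M\<in>ambiguity_set \<epsilon> K s. ?p M) + ereal \<eta>"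
      by (intro INF_lower2[of l]) auto
  qed
qed

section \<open>The dual reformulation of each agent's problem\<close>

text \<open>The duality is applied separately for each \<open>y\<close>, with
  \<open>p = P i (profile i y z)\<close> and \<open>a = f i y z\<close>. The infimum over the
  multiplier then merges with the outer one over \<open>y\<close>, and no minimax exchange over
  \<open>y\<close> occurs.\<close>

theorem lemma3p1:
  fixes X :: "'N::finite \<Rightarrow> (real^'n) set"
    and f :: "'N \<Rightarrow> real^'n \<Rightarrow> ('N \<Rightarrow> real^'n) \<Rightarrow> real"
    and g :: "'N \<Rightarrow> real^'n \<Rightarrow> ('N \<Rightarrow> real^'n) \<Rightarrow> real^('m::{finite,linorder}) \<Rightarrow> real"
    and P :: "'N \<Rightarrow> real^'n^'N \<Rightarrow> real^('m::{finite,linorder})"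
    and A :: "'N \<Rightarrow> real^('N \<times> 'n)^('m::{finite,linorder})"
    and b :: "'N \<Rightarrow> real^('m::{finite,linorder})"
    and Q L D :: "'N \<Rightarrow> real^('m::{finite,linorder})^('m::{finite,linorder})"
    and \<epsilon> :: "'N \<Rightarrow> real"
    and K :: "'N \<Rightarrow> nat"
    and \<xi>s :: "'N \<Rightarrow> nat \<Rightarrow> real^('m::{finite,linorder})"
  assumes f_convex: "\<And>i z. z \<in> opponents X i \<Longrightarrow> convex_on UNIV (\<lambda>y. f i y z)"
    and g_quadratic: "\<And>i y z \<xi>. z \<in> opponents (\<lambda>_. UNIV) i \<Longrightarrow>
      g i y z \<xi> = \<xi> \<bullet> (Q i *v \<xi>) + P i (profile i y z) \<bullet> \<xi>"
    and P_affine: "\<And>i x. P i x = A i *v stack x + b i"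
    and Q_decomp: "\<And>i. Q i = transpose (L i) ** D i ** L i"
    and L_orthogonal: "\<And>i. orthogonal_matrix (L i)"
    and D_diagonal: "\<And>i. diagonal_matrix (D i)"
    and D_psd: "\<And>i. pos_semidef (D i)"
    and D_sorted: "\<And>i. sorted_diagonal (D i)"
    and radius_nonneg: "\<And>i. 0 \<le> \<epsilon> i"
    and samples_nonempty: "\<And>i. 1 \<le> K i"
  shows "\<forall>i. \<forall>z \<in> opponents X i.
    primal_value (f i) (g i) (\<epsilon> i) (K i) (\<xi>s i) (X i) z =
    (INF (y, l) \<in> X i \<times> {0..}. dual_objective i (f i) (Q i) (P i) (\<epsilon> i) (K i) (\<xi>s i) y l z)"
proof (intro allI ballI)
  fix i z assume z: "z \<in> opponents X i"
  then have "z \<in> opponents (\<lambda>_. UNIV) i"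
    by (auto simp: opponents_def PiE_def)
  then have g: "g i y z = (\<lambda>\<xi>. \<xi> \<bullet> (Q i *v \<xi>) + P i (profile i y z) \<bullet> \<xi>)" for y
    using g_quadratic by blast
  have "primal_value (f i) (g i) (\<epsilon> i) (K i) (\<xi>s i) (X i) z
      = (INF y\<in>X i. INF l\<in>{0..}. dual_objective i (f i) (Q i) (P i) (\<epsilon> i) (K i) (\<xi>s i) y l z)"
    unfolding primal_value_def dual_objective_def g
    by (intro INF_cong refl wasserstein_quadratic_duality[OF Q_decomp L_orthogonal D_diagonal D_psd
          radius_nonneg samples_nonempty])
  also have "\<dots> = (INF (y, l) \<in> X i \<times> {0..}.
      dual_objective i (f i) (Q i) (P i) (\<epsilon> i) (K i) (\<xi>s i) y l z)"
    by (auto intro!: antisym INF_greatest intro: INF_lower2 INF_lower)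
  finally show "primal_value (f i) (g i) (\<epsilon> i) (K i) (\<xi>s i) (X i) z =
    (INF (y, l) \<in> X i \<times> {0..}. dual_objective i (f i) (Q i) (P i) (\<epsilon> i) (K i) (\<xi>s i) y l z)" .
qed

end
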